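(* Let $\mathbb{X}$ and $\mathbb{U}$ be connected, second countable differentiable manifolds, with $r=\dim\mathbb{X}$, and let $\beta:\mathbb{X}\times\mathbb{U}\to\mathbb{R}$ be a map such that $\beta(\cdot,u)$ is continuously differentiable for each $u\in\mathbb{U}$. Then there exists an open dense subset $\mathbb{X}_0$ of $\mathbb{X}$ with the following property: for each $x\in\mathbb{X}_0$ there is some neighborhood $V$ of $x$ such that $\mathcal{G}_{\beta,r,V}$ is nonempty.
   Context: For a positive integer $q$, $\mathbb{U}^{(q)}$ denotes the set of $q$-tuples of pairwise distinct elements of $\mathbb{U}$. For $w=(u_1,\ldots,u_q)\in\mathbb{U}^{(q)}$, $\beta(x,w):=(\beta(x,u_1),\ldots,\beta(x,u_q))\in\mathbb{R}^q$. Parameters $x_1,x_2\in\mathbb{X}$ are distinguishable, written $x_1\not\sim x_2$, if $\beta(x_1,u)\neq\beta(x_2,u)$ for some $u\in\mathbb{U}$. For an open subset $V\subseteq\mathbb{X}$, $$\mathcal{B}_{\beta,q,V}:=\{w\in\mathbb{U}^{(q)}\mid \exists\,x_1,x_2\in V\text{ such that }x_1\not\sim x_2\text{ and }\beta(x_1,w)=\beta(x_2,w)\},\qquad \mathcal{G}_{\beta,q,V}:=\mathbb{U}^{(q)}\setminus\mathcal{B}_{\beta,q,V}.$$ Neighborhoods are taken to be open.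
   Formalization: U is assumed nonempty and, when r ≥ 2, of dimension at least 1: if U is empty or (with r ≥ 2) a single point, there are no r-tuples of distinct elements, so the claim fails. The dimension r is taken to be at least 1, since tuples are defined only for positive q. *)

theory Defs
  imports "HOL-Analysis.Analysis"
begin

section \<open>Continuously differentiable manifolds\<close>

text \<open>Only meant for open sets \<open>S\<close>: the derivative at a point of \<open>S\<close> is the full
  Frechet derivative, and it has to depend continuously on the point in operator norm.\<close>

definition C1_on :: "('e::real_normed_vector \<Rightarrow> 'f::real_normed_vector) \<Rightarrow> 'e set \<Rightarrow> bool" where
  "C1_on f S \<longleftrightarrow>
     (\<exists>f' :: 'e \<Rightarrow> ('e \<Rightarrow>\<^sub>L 'f).
        (\<forall>x\<in>S. (f has_derivative blinfun_apply (f' x)) (at x)) \<and> continuous_on S f')"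

text \<open>A chart is a pair of a domain and a map; values of the map outside the domain are
  irrelevant.\<close>

definition is_chart :: "'a topology \<Rightarrow> 'a set \<times> ('a \<Rightarrow> 'e::real_normed_vector) \<Rightarrow> bool" where
  "is_chart M = (\<lambda>(D, \<phi>).
     openin M D \<and> open (\<phi> ` D) \<and>
     homeomorphic_map (subtopology M D) (top_of_set (\<phi> ` D)) \<phi>)"

text \<open>The model space is a finite-dimensional normed space of dimension \<open>n\<close> rather than the
  concrete space of real \<open>n\<close>-tuples. Euclidean spaces in Isabelle have positive dimension, so
  the class of real normed spaces is what admits \<open>n = 0\<close>. An atlas whose transition maps are
  continuously differentiable is the least structure for which continuous differentiability
  of functions makes sense; every smooth or analytic atlas is one.\<close>

definition differentiable_manifold ::
    "nat \<Rightarrow> 'a topology \<Rightarrow> ('a set \<times> ('a \<Rightarrow> 'e::real_normed_vector)) set \<Rightarrow> bool" where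
  "differentiable_manifold n M A \<longleftrightarrow>
     (\<exists>B :: 'e set. finite B \<and> independent B \<and> span B = UNIV \<and> card B = n) \<and>
     Hausdorff_space M \<and>
     (\<forall>c\<in>A. is_chart M c) \<and>
     (\<Union>c\<in>A. fst c) = topspace M \<and>
     (\<forall>(D, \<phi>)\<in>A. \<forall>(E, \<psi>)\<in>A. C1_on (\<psi> \<circ> inv_into D \<phi>) (\<phi> ` (D \<inter> E)))"

definition C1_function ::
    "('a set \<times> ('a \<Rightarrow> 'e::real_normed_vector)) set \<Rightarrow> ('a \<Rightarrow> real) \<Rightarrow> bool" where
  "C1_function A g \<longleftrightarrow> (\<forall>(D, \<phi>)\<in>A. C1_on (g \<circ> inv_into D \<phi>) (\<phi> ` D))"

section \<open>Distinguishability by experiments\<close>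

text \<open>In this section \<open>U\<close> is the set of experiments (the underlying set of the manifold), and
  \<open>q\<close>-tuples are lists of length \<open>q\<close>, so that the response to a tuple \<open>w\<close> of experiments is
  \<open>map (\<beta> x) w\<close>.\<close>

definition distinguishable :: "('a \<Rightarrow> 'b \<Rightarrow> real) \<Rightarrow> 'b set \<Rightarrow> 'a \<Rightarrow> 'a \<Rightarrow> bool" where
  "distinguishable \<beta> U x1 x2 \<longleftrightarrow> (\<exists>u\<in>U. \<beta> x1 u \<noteq> \<beta> x2 u)"

definition distinct_tuples :: "nat \<Rightarrow> 'b set \<Rightarrow> 'b list set" where
  "distinct_tuples q U = {w. length w = q \<and> distinct w \<and> set w \<subseteq> U}"

definition bad_tuples :: "('a \<Rightarrow> 'b \<Rightarrow> real) \<Rightarrow> 'b set \<Rightarrow> nat \<Rightarrow> 'a set \<Rightarrow> 'b list set" where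
  "bad_tuples \<beta> U q V =
     {w \<in> distinct_tuples q U.
        \<exists>x1\<in>V. \<exists>x2\<in>V. distinguishable \<beta> U x1 x2 \<and> map (\<beta> x1) w = map (\<beta> x2) w}"

definition good_tuples :: "('a \<Rightarrow> 'b \<Rightarrow> real) \<Rightarrow> 'b set \<Rightarrow> nat \<Rightarrow> 'a set \<Rightarrow> 'b list set" where
  "good_tuples \<beta> U q V = distinct_tuples q U - bad_tuples \<beta> U q V"

end

theory Submission
  imports Defs
begin

text \<open>
  Where the rank of the span of the gradients of all \<open>\<beta>(\<cdot>, u)\<close> attains a local maximum, it is
  locally constant; such points occur in every nonempty open set. Near one, choose
  \<open>k \<le> r\<close> experiments whose gradients form a basis of this span and complete their responses to
  local coordinates. By maximality every \<open>\<beta>(\<cdot>, u)\<close> has zero derivative in the remaining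
  coordinate directions, so on a neighbourhood that does not depend on \<open>u\<close> it is a function of
  the \<open>k\<close> responses. Padding to \<open>r\<close> distinct experiments gives a good tuple.
\<close>

section \<open>Linear algebra of gradients, and local coordinates in Euclidean space\<close>

lemma C1_on_imp_gradient:
  fixes f :: "'e::euclidean_space \<Rightarrow> real"
  assumes "C1_on f S"
  obtains G where "\<And>x. x \<in> S \<Longrightarrow> (f has_derivative (\<lambda>h. G x \<bullet> h)) (at x)" "continuous_on S G"
proof -
  obtain f' :: "'e \<Rightarrow> 'e \<Rightarrow>\<^sub>L real" where f': "\<And>x. x \<in> S \<Longrightarrow> (f has_derivative f' x) (at x)"
    and cont: "continuous_on S f'"
    using assms unfolding C1_on_def by blast
  \<comment> \<open>\<open>G x\<close> is the Riesz representative of \<open>f' x\<close>; as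
    vectors of \<open>'e\<close>, derivatives have spans and dimensions.\<close>
  define G where "G x = (\<Sum>i\<in>Basis. f' x i *\<^sub>R i)" for x
  have "blinfun_apply (f' x) = (\<lambda>h. G x \<bullet> h)" for x
  proof
    fix h
    have "f' x h = f' x (\<Sum>i\<in>Basis. (h \<bullet> i) *\<^sub>R i)"
      by (simp add: euclidean_representation)
    also have "\<dots> = G x \<bullet> h"
      by (simp add: G_def blinfun.sum_right blinfun.scaleR_right inner_sum_right inner_commute[of _ h] mult.commute)
    finally show "f' x h = G x \<bullet> h" .
  qed
  moreover have "continuous_on S G"
    unfolding G_def by (intro continuous_intros cont)
  ultimately show thesis
    using that f' by metis
qed

lemma independent_sum_cancel:
  fixes B :: "'e::real_vector set"
  assumes "independent B" "finite B" "(\<Sum>b\<in>B. c b *\<^sub>R b) = (\<Sum>b\<in>B. d b *\<^sub>R b)" "b \<in> B"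
  shows "c b = d b"
proof -
  have "(\<Sum>b\<in>B. (c b - d b) *\<^sub>R b) = 0"
    using assms(3) by (simp add: scaleR_left_diff_distrib sum_subtractf)
  from independentD[OF assms(1,2) subset_refl this assms(4)] show ?thesis
    by simp
qed

text \<open>A vector killed by this linear map is orthogonal to \<open>B\<close>, hence to its span,
  hence to itself. The map arises below as the derivative of a coordinate map at the base
  point.\<close>

lemma inj_frame_map:
  fixes B :: "'e::euclidean_space set"
  assumes "independent B" "finite B" "span B = UNIV"
  shows "inj (\<lambda>h. \<Sum>b\<in>B. (b \<bullet> h) *\<^sub>R b)"
proof (rule injI)
  fix x y assume "(\<Sum>b\<in>B. (b \<bullet> x) *\<^sub>R b) = (\<Sum>b\<in>B. (b \<bullet> y) *\<^sub>R b)"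
  then have "b \<bullet> x = b \<bullet> y" if "b \<in> B" for b
    using independent_sum_cancel[OF assms(1,2), of "\<lambda>b. b \<bullet> x" "\<lambda>b. b \<bullet> y"] that by blast
  then have "orthogonal (x - y) b" if "b \<in> B" for b
    using that by (simp add: orthogonal_def inner_diff_left inner_diff_right inner_commute[of _ b])
  then have "orthogonal (x - y) (x - y)"
    using orthogonal_to_span[of "x - y" B] assms(3) by auto
  then show "x = y"
    by (simp add: orthogonal_def)
qed

text \<open>By \<open>a0\<close> the coordinate map has at \<open>p0\<close> the injective
  derivative of \<open>inj_frame_map\<close>, so the inverse function theorem applies. Convexity of
  \<open>V\<close> lets straight segments in coordinates be lifted by \<open>g\<close>.\<close>

lemma local_coordinates:
  fixes f :: "'e::euclidean_space \<Rightarrow> 'e \<Rightarrow> real" and a :: "'e \<Rightarrow> 'e \<Rightarrow> 'e"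
  assumes B: "independent B" "finite B" "span B = UNIV"
    and W: "open W" "p0 \<in> W"
    and der: "\<And>b p. b \<in> B \<Longrightarrow> p \<in> W \<Longrightarrow> (f b has_derivative (\<lambda>h. a b p \<bullet> h)) (at p)"
    and cont: "\<And>b. b \<in> B \<Longrightarrow> continuous_on W (a b)"
    and a0: "\<And>b. b \<in> B \<Longrightarrow> a b p0 = b"
  obtains W' V g g' where "open W'" "W' \<subseteq> W" "p0 \<in> W'" "convex V"
    "homeomorphism W' V (\<lambda>p. \<Sum>b\<in>B. f b p *\<^sub>R b) g"
    "\<forall>y\<in>V. (g has_derivative g' y) (at y)"
    "\<forall>y\<in>V. \<forall>h. (\<Sum>b\<in>B. (a b (g y) \<bullet> g' y h) *\<^sub>R b) = h"
    "\<forall>p\<in>W'. surj (\<lambda>h. \<Sum>b\<in>B. (a b p \<bullet> h) *\<^sub>R b)"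
proof -
  define \<Phi> where "\<Phi> p = (\<Sum>b\<in>B. f b p *\<^sub>R b)" for p
  define \<Phi>' where "\<Phi>' p = (\<Sum>b\<in>B. blinfun_scaleR_left b o\<^sub>L blinfun_inner_right (a b p))" for p
  have \<Phi>'_apply: "blinfun_apply (\<Phi>' p) = (\<lambda>h. \<Sum>b\<in>B. (a b p \<bullet> h) *\<^sub>R b)" for p
    by (rule ext) (simp add: \<Phi>'_def blinfun.sum_left)
  have der\<Phi>: "(\<Phi> has_derivative blinfun_apply (\<Phi>' p)) (at p)" if "p \<in> W" for p
    unfolding \<Phi>_def \<Phi>'_apply
    by (intro has_derivative_sum has_derivative_scaleR_left der that)
  have cont\<Phi>: "continuous_on W \<Phi>'"
    unfolding \<Phi>'_def
    by (intro continuous_intros bounded_linear.continuous_on[OF bounded_linear_blinfun_inner_right] cont)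
  have inj0: "inj (\<Phi>' p0)"
    using inj_frame_map[OF B] a0 by (simp add: \<Phi>'_apply cong: sum.cong)
  have "linear (\<Phi>' p0)"
    by (simp add: blinfun.bounded_linear_right bounded_linear.linear)
  then obtain k where k: "linear k" "\<And>x. k (\<Phi>' p0 x) = x"
    using linear_injective_isomorphism[of "blinfun_apply (\<Phi>' p0)"] inj0 by auto
  have "Blinfun k o\<^sub>L \<Phi>' p0 = id_blinfun"
    using k by (intro blinfun_eqI) (simp add: bounded_linear_Blinfun_apply linear_linear)
  from inverse_function_theorem[OF W(1) der\<Phi> cont\<Phi> W(2) this]
  obtain W1 V1 g g' where *: "open W1" "W1 \<subseteq> W" "p0 \<in> W1" "open V1" "\<Phi> p0 \<in> V1"
    and hom: "homeomorphism W1 V1 \<Phi> g"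
    and g: "\<And>y. y \<in> V1 \<Longrightarrow> (g has_derivative g' y) (at y)"
    "\<And>y. y \<in> V1 \<Longrightarrow> g' y = inv (\<Phi>' (g y))" "\<And>y. y \<in> V1 \<Longrightarrow> bij (\<Phi>' (g y))"
    by metis
  \<comment> \<open>The inverse function theorem gives an open \<open>V1\<close> only; shrinking it
    to a ball makes the coordinate image convex.\<close>
  obtain e where e: "e > 0" "ball (\<Phi> p0) e \<subseteq> V1"
    using * open_contains_ball by blast
  define W' where "W' = g ` ball (\<Phi> p0) e"
  have W'1: "W' \<subseteq> W1"
    using hom e by (auto simp: W'_def homeomorphism_def)
  \<comment> \<open>Seen as a preimage, \<open>W'\<close> is open by continuity of
    \<open>\<Phi>\<close>.\<close>
  have W'_eq: "W' = W1 \<inter> \<Phi> -` ball (\<Phi> p0) e"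
    using hom e W'1 unfolding homeomorphism_def W'_def by (force simp: image_iff)
  have "continuous_on W1 \<Phi>"
    using hom by (simp add: homeomorphism_def)
  then have "open W'"
    unfolding W'_eq using \<open>open W1\<close> by (simp add: continuous_on_open_vimage Int_commute)
  moreover have "W' \<subseteq> W" "p0 \<in> W'"
    using * W'1 e by (auto simp: W'_eq)
  moreover have "homeomorphism W' (ball (\<Phi> p0) e) \<Phi> g"
    by (rule homeomorphism_of_subsets[OF hom W'1])
       (use hom e in \<open>auto simp: W'_def homeomorphism_def image_image subset_iff\<close>)
  moreover have "(\<Sum>b\<in>B. (a b (g y) \<bullet> g' y h) *\<^sub>R b) = h" if "y \<in> ball (\<Phi> p0) e" for y h
  proof -
    have "y \<in> V1" using e that by blast
    then have "\<Phi>' (g y) (g' y h) = h"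
      using g(2,3)[of y] by (simp add: bij_is_surj surj_f_inv_f)
    then show ?thesis by (simp add: \<Phi>'_apply)
  qed
  moreover have "surj (\<lambda>h. \<Sum>b\<in>B. (a b p \<bullet> h) *\<^sub>R b)" if "p \<in> W'" for p
    using g(3) that e by (auto simp: W'_def \<Phi>'_apply[symmetric] bij_is_surj)
  ultimately show thesis
    using that[of W' "ball (\<Phi> p0) e" g g'] e g(1) unfolding \<Phi>_def by (simp add: subset_iff)
qed

text \<open>Surjectivity yields for each \<open>b0\<close> in \<open>C\<close> a vector pairing to 1
  with \<open>a b0\<close> and to 0 with \<open>a b\<close> for the other \<open>b\<close> in
  \<open>C\<close>. Hence \<open>a\<close> is injective on \<open>C\<close> with independent image,
  and \<open>card C\<close> independent vectors in a set of dimension at most \<open>card C\<close>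
  span it.\<close>

lemma span_gradients_maximal:
  fixes a :: "'e::euclidean_space \<Rightarrow> 'e"
  assumes "independent B" "finite B" "C \<subseteq> B"
    and surj: "surj (\<lambda>h. \<Sum>b\<in>B. (a b \<bullet> h) *\<^sub>R b)"
    and "a ` C \<subseteq> S" "dim S \<le> card C"
  shows "S \<subseteq> span (a ` C)"
proof -
  have dual: "\<exists>h. a b0 \<bullet> h = 1 \<and> (\<forall>b\<in>C - {b0}. a b \<bullet> h = 0)" if "b0 \<in> C" for b0
  proof -
    obtain h where h: "(\<Sum>b\<in>B. (a b \<bullet> h) *\<^sub>R b) = b0"
      using surjD[OF surj, of b0] by metis
    \<comment> \<open>Expanding \<open>b0\<close> in the basis \<open>B\<close> allows coefficients
      to be compared.\<close>
    have "(\<Sum>b\<in>B. (if b = b0 then 1 else 0) *\<^sub>R b) = (\<Sum>b\<in>B. if b = b0 then b else 0)"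
      by (rule sum.cong) auto
    also have "\<dots> = b0"
      using that assms(2,3) by (auto simp: sum.delta)
    finally have "(\<Sum>b\<in>B. (a b \<bullet> h) *\<^sub>R b) = (\<Sum>b\<in>B. (if b = b0 then 1 else 0) *\<^sub>R b)"
      using h by simp
    then have "a b \<bullet> h = (if b = b0 then 1 else 0)" if "b \<in> B" for b
      by (rule independent_sum_cancel[OF assms(1,2)]) (rule that)
    then show ?thesis
      using that assms(3) by (intro exI[of _ h]) (auto simp: subset_iff split: if_splits)
  qed
  have fin: "finite C"
    using assms(2,3) finite_subset by blast
  have inj: "inj_on a C"
    by (rule inj_onI) (metis Diff_iff dual empty_iff insert_iff zero_neq_one)
  have "independent (a ` C)"
  proof (rule independent_if_scalars_zero)
    fix c x assume 0: "(\<Sum>x\<in>a ` C. c x *\<^sub>R x) = 0" and "x \<in> a ` C"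
    then obtain b0 where b0: "b0 \<in> C" "x = a b0" by blast
    obtain h where h: "a b0 \<bullet> h = 1" "\<And>b. b \<in> C - {b0} \<Longrightarrow> a b \<bullet> h = 0"
      using dual[OF b0(1)] by blast
    have "0 = (\<Sum>b\<in>C. c (a b) *\<^sub>R a b) \<bullet> h"
      using 0 by (simp add: sum.reindex[OF inj])
    also have "\<dots> = (\<Sum>b\<in>C. c (a b) * (a b \<bullet> h))"
      by (simp add: inner_sum_left)
    also have "\<dots> = c (a b0)"
      using h by (simp add: sum.remove[OF fin b0(1)])
    finally show "c x = 0" using b0 by simp
  qed (use fin in auto)
  then show ?thesis
    using card_ge_dim_independent[of "a ` C" S] assms(5,6) by (simp add: card_image[OF inj])
qed

section \<open>Constant rank and functional dependence\<close>

text \<open>Two points of \<open>W'\<close> with equal values on \<open>T0\<close> are joined by a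
  curve, straight in suitable coordinates, along which every \<open>g u\<close> has derivative zero.
  The coordinates are fixed before \<open>u\<close>, so a single \<open>W'\<close> serves all of
  \<open>T\<close>, even an infinite one.\<close>

lemma finitely_many_functions_determine_all:
  fixes g :: "'b \<Rightarrow> 'e::euclidean_space \<Rightarrow> real"
  assumes W: "open W" "W \<noteq> {}"
    and C1: "\<And>u. u \<in> T \<Longrightarrow> C1_on (g u) W"
  obtains W' T0 where "open W'" "W' \<noteq> {}" "W' \<subseteq> W" "T0 \<subseteq> T" "finite T0" "card T0 \<le> DIM('e)"
    "\<And>p q u. \<lbrakk>p \<in> W'; q \<in> W'; \<And>v. v \<in> T0 \<Longrightarrow> g v p = g v q; u \<in> T\<rbrakk> \<Longrightarrow> g u p = g u q"
proof -
  have "\<exists>G. (\<forall>x\<in>W. (g u has_derivative (\<lambda>h. G x \<bullet> h)) (at x)) \<and> continuous_on W G" if "u \<in> T" for u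
    using C1_on_imp_gradient[OF C1[OF that]] by metis
  then obtain G where der: "\<And>u p. u \<in> T \<Longrightarrow> p \<in> W \<Longrightarrow> (g u has_derivative (\<lambda>h. G u p \<bullet> h)) (at p)"
    and cont: "\<And>u. u \<in> T \<Longrightarrow> continuous_on W (G u)"
    by metis
  define S where "S p = (\<lambda>u. G u p) ` T" for p
  obtain p1 where "p1 \<in> W" using W by blast
  \<comment> \<open>The dimensions are bounded by \<open>DIM('e)\<close>, so their maximum over
    \<open>W\<close> is attained.\<close>
  then obtain p0 where p0: "p0 \<in> W" and max: "\<And>p. p \<in> W \<Longrightarrow> dim (S p) \<le> dim (S p0)"
    using ex_has_greatest_nat[of "\<lambda>p. p \<in> W" p1 "\<lambda>p. dim (S p)" "DIM('e) + 1"]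
    by (metis dim_subset_UNIV less_Suc_eq_le Suc_eq_plus1)
  obtain C where C: "C \<subseteq> S p0" "independent C" "S p0 \<subseteq> span C" "card C = dim (S p0)"
    by (rule basis_exists)
  obtain B where B: "C \<subseteq> B" "independent B" "span B = UNIV"
    using maximal_independent_subset_extend[OF subset_UNIV C(2)] by (metis top.extremum_uniqueI)
  have fin: "finite B" "finite C"
    using B C(2) independent_imp_finite by blast+
  \<comment> \<open>For each basis gradient \<open>b\<close>, one experiment \<open>u b\<close>
    realising it at \<open>p0\<close>.\<close>
  obtain u where u: "\<And>b. b \<in> C \<Longrightarrow> u b \<in> T" "\<And>b. b \<in> C \<Longrightarrow> G (u b) p0 = b"
  proof
    show "inv_into T (\<lambda>u. G u p0) b \<in> T" "G (inv_into T (\<lambda>u. G u p0) b) p0 = b" if "b \<in> C" for b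
      using that C(1) inv_into_into[of b "\<lambda>u. G u p0" T] f_inv_into_f[of b "\<lambda>u. G u p0" T]
      by (auto simp: S_def)
  qed
  \<comment> \<open>With this choice the coordinate map below has derivative \<open>h \<mapsto> (\<Sum>b\<in>B. (b \<bullet> h) *\<^sub>R b)\<close> at
    \<open>p0\<close>, which is invertible for every basis \<open>B\<close>.\<close>
  define f where "f b = (if b \<in> C then g (u b) else (\<lambda>p. b \<bullet> p))" for b
  define a where "a b p = (if b \<in> C then G (u b) p else b)" for b p
  have der_f: "(f b has_derivative (\<lambda>h. a b p \<bullet> h)) (at p)" if "b \<in> B" "p \<in> W" for b p
    using der[OF u(1) that(2)] by (auto simp: f_def a_def intro!: derivative_eq_intros)
  have cont_a: "continuous_on W (a b)" if "b \<in> B" for b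
    using cont[OF u(1)] by (cases "b \<in> C") (simp_all add: a_def)
  have a_p0: "a b p0 = b" if "b \<in> B" for b
    using u by (simp add: a_def)
  obtain W' V k k' where W': "open W'" "W' \<subseteq> W" "p0 \<in> W'" and "convex V"
    and hom: "homeomorphism W' V (\<lambda>p. \<Sum>b\<in>B. f b p *\<^sub>R b) k"
    and k [rule_format]: "\<forall>y\<in>V. (k has_derivative k' y) (at y)"
      "\<forall>y\<in>V. \<forall>h. (\<Sum>b\<in>B. (a b (k y) \<bullet> k' y h) *\<^sub>R b) = h"
    and surj [rule_format]: "\<forall>p\<in>W'. surj (\<lambda>h. \<Sum>b\<in>B. (a b p \<bullet> h) *\<^sub>R b)"
    by (rule local_coordinates[OF B(2) fin(1) B(3) W(1) p0 der_f cont_a a_p0])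
  \<comment> \<open>The gradients of the chosen functions stay independent on \<open>W'\<close>, so
    the rank does not drop; by \<open>max\<close> it does not grow either.\<close>
  have spanS: "S p \<subseteq> span ((\<lambda>b. a b p) ` C)" if "p \<in> W'" for p
  proof (rule span_gradients_maximal[OF B(2) fin(1) B(1) surj[OF that]])
    show "(\<lambda>b. a b p) ` C \<subseteq> S p"
      using u(1) by (auto simp: a_def S_def)
    show "dim (S p) \<le> card C"
      using max C(4) W'(2) that by auto
  qed
  have "g v p = g v q"
    if pq: "p \<in> W'" "q \<in> W'" and eq: "\<And>v. v \<in> u ` C \<Longrightarrow> g v p = g v q" and v: "v \<in> T" for p q v
  proof -
    \<comment> \<open>The segment between the coordinates of \<open>p\<close> and \<open>q\<close>,
      written so that its constant velocity can be read off.\<close>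
    define y where "y t = (\<Sum>b\<in>B. f b p *\<^sub>R b) + t *\<^sub>R (\<Sum>b\<in>B. (f b q - f b p) *\<^sub>R b)" for t :: real
    have y_conv: "y t = (1 - t) *\<^sub>R (\<Sum>b\<in>B. f b p *\<^sub>R b) + t *\<^sub>R (\<Sum>b\<in>B. f b q *\<^sub>R b)" for t
      by (simp add: y_def scaleR_left_diff_distrib sum_subtractf algebra_simps)
    have ends: "(\<Sum>b\<in>B. f b p *\<^sub>R b) \<in> V" "(\<Sum>b\<in>B. f b q *\<^sub>R b) \<in> V"
      using hom pq by (auto simp: homeomorphism_def)
    have yV: "y t \<in> V" if "t \<in> {0..1}" for t
      unfolding y_conv using that \<open>convex V\<close> ends by (intro convexD) auto
    have ky: "k (y 0) = p" "k (y 1) = q"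
      using hom pq by (auto simp: y_conv homeomorphism_def)
    have "((\<lambda>t. g v (k (y t))) has_derivative (\<lambda>s. 0)) (at t within {0..1})" if t: "t \<in> {0..1}" for t
    proof -
      let ?w = "\<Sum>b\<in>B. (f b q - f b p) *\<^sub>R b"
      have kW': "k (y t) \<in> W'"
        using hom yV[OF t] by (auto simp: homeomorphism_def)
      \<comment> \<open>Since \<open>p\<close> and \<open>q\<close> agree on the chosen functions,
        the velocity \<open>?w\<close> has no component along \<open>C\<close>; its lift by
        \<open>k'\<close> is thus orthogonal to their gradients.\<close>
      have perp: "orthogonal (k' (y t) (s *\<^sub>R ?w)) (a b (k (y t)))" if b: "b \<in> C" for b s
      proof -
        have "(\<Sum>b\<in>B. (a b (k (y t)) \<bullet> k' (y t) (s *\<^sub>R ?w)) *\<^sub>R b) = (\<Sum>b\<in>B. (s * (f b q - f b p)) *\<^sub>R b)"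
          by (simp add: k(2)[OF yV[OF t]] scaleR_sum_right)
        then have "a b (k (y t)) \<bullet> k' (y t) (s *\<^sub>R ?w) = s * (f b q - f b p)"
          by (rule independent_sum_cancel[OF B(2) fin(1)]) (use b B(1) in blast)
        then show ?thesis
          using eq b by (simp add: orthogonal_def f_def inner_commute)
      qed
      have "G v (k (y t)) \<in> span ((\<lambda>b. a b (k (y t))) ` C)"
        using spanS[OF kW'] v by (auto simp: S_def)
      then have "orthogonal (k' (y t) (s *\<^sub>R ?w)) (G v (k (y t)))" for s
        by (rule orthogonal_to_span) (use perp in auto)
      then have zero: "G v (k (y t)) \<bullet> k' (y t) (s *\<^sub>R ?w) = 0" for s
        by (simp add: orthogonal_def inner_commute)
      have dy: "(y has_derivative (\<lambda>s. s *\<^sub>R ?w)) (at t within {0..1})"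
        unfolding y_def by (auto intro!: derivative_eq_intros)
      have "((\<lambda>t. g v (k (y t))) has_derivative (\<lambda>s. G v (k (y t)) \<bullet> k' (y t) (s *\<^sub>R ?w)))
          (at t within {0..1})"
        using W'(2) kW' by (intro has_derivative_compose[OF _ der[OF v]]
          has_derivative_compose[OF dy k(1)[OF yV[OF t]]]) auto
      then show ?thesis by (simp add: zero)
    qed
    from has_derivative_zero_unique[OF convex_real_interval(5) this, of 0 1] show ?thesis
      by (simp add: ky)
  qed
  moreover have "card (u ` C) \<le> DIM('e)"
    using card_image_le[OF fin(2), of u] C(4) dim_subset_UNIV[of "S p0"] by linarith
  ultimately show thesis
    using that[of W' "u ` C"] W' u(1) fin(2) by blast
qed

section \<open>Supply of distinct experiments\<close>

text \<open>A chart image contains a ball, and \<open>n \<ge> 1\<close> provides a nonzero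
  direction, so the image contains a whole segment.\<close>

lemma infinite_manifold:
  fixes A :: "('a set \<times> ('a \<Rightarrow> 'e::real_normed_vector)) set"
  assumes "differentiable_manifold n M A" "n \<ge> 1" "topspace M \<noteq> {}"
  shows "infinite (topspace M)"
proof
  assume fin: "finite (topspace M)"
  have cover: "(\<Union>c\<in>A. fst c) = topspace M" and chart: "\<And>c. c \<in> A \<Longrightarrow> is_chart M c"
    using assms(1) by (simp_all add: differentiable_manifold_def)
  then obtain D \<phi> x where D: "(D, \<phi>) \<in> A" "x \<in> D"
    using assms(3) by fastforce
  then have "open (\<phi> ` D)"
    using chart by (auto simp: is_chart_def)
  then obtain e where e: "e > 0" "ball (\<phi> x) e \<subseteq> \<phi> ` D"
    using D(2) open_contains_ball by blast
  obtain B :: "'e set" where "independent B" "card B = n"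
    using assms(1) by (auto simp: differentiable_manifold_def)
  then obtain v where v: "v \<in> B" "v \<noteq> 0"
    using assms(2) dependent_zero by (metis One_nat_def all_not_in_conv card.empty not_less_eq_eq zero_le)
  have "\<phi> x + t *\<^sub>R v \<in> \<phi> ` D" if "t \<in> {0<..<e / norm v}" for t
    using that v e(2) by (intro subsetD[OF e(2)]) (auto simp: dist_norm field_simps)
  then have "(\<lambda>t. \<phi> x + t *\<^sub>R v) ` {0<..<e / norm v} \<subseteq> \<phi> ` D"
    by blast
  moreover have "infinite ((\<lambda>t. \<phi> x + t *\<^sub>R v) ` {0<..<e / norm v})"
    using v e(1) by (subst finite_image_iff) (auto simp: inj_on_def)
  ultimately have "infinite D"
    using finite_subset by blast
  moreover have "D \<subseteq> topspace M"
    using D(1) cover by force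
  ultimately show False
    using fin finite_subset by blast
qed

lemma finite_subset_extend_card:
  assumes "finite S" "S \<subseteq> T" "card S \<le> n" "finite T \<Longrightarrow> n \<le> card T"
  obtains S' where "S \<subseteq> S'" "S' \<subseteq> T" "finite S'" "card S' = n"
proof (cases "finite T")
  case True
  then show ?thesis
    using exists_subset_between[of S n T] assms that finite_subset by metis
next
  case False
  then obtain R where "R \<subseteq> T - S" "finite R" "card R = n - card S"
    using infinite_arbitrarily_large[of "T - S"] assms(1) by (metis Diff_infinite_finite)
  moreover from this have "card (S \<union> R) = card S + card R"
    using assms(1) by (intro card_Un_disjoint) auto
  ultimately show ?thesis
    using assms(1-3) by (intro that[of "S \<union> R"]) auto
qed

section \<open>Passage from charts to the manifold, and density\<close>

theorem proposition2p2:
  fixes X :: "'a topology" and AX :: "('a set \<times> ('a \<Rightarrow> 'e::euclidean_space)) set"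
    and U :: "'b topology" and AU :: "('b set \<times> ('b \<Rightarrow> 'f::real_normed_vector)) set"
    and r d :: nat
    and \<beta> :: "'a \<Rightarrow> 'b \<Rightarrow> real"
  assumes "differentiable_manifold r X AX" "connected_space X" "second_countable X"
    and "differentiable_manifold d U AU" "connected_space U" "second_countable U"
    and "topspace U \<noteq> {}"
    and "r \<ge> 2 \<Longrightarrow> d \<ge> 1"
    and "\<And>u. u \<in> topspace U \<Longrightarrow> C1_function AX (\<lambda>x. \<beta> x u)"
  shows "\<exists>X0. openin X X0 \<and> X closure_of X0 = topspace X \<and>
           (\<forall>x\<in>X0. \<exists>V. openin X V \<and> x \<in> V \<and> good_tuples \<beta> (topspace U) r V \<noteq> {})"
proof -
  \<comment> \<open>As the union of all open sets admitting a good tuple, \<open>X0\<close> is open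
    and has the required property by construction; only density takes work.\<close>
  define X0 where "X0 = \<Union>{V. openin X V \<and> good_tuples \<beta> (topspace U) r V \<noteq> {}}"
  obtain B :: "'e set" where "independent B" "span B = UNIV" "card B = r"
    using assms(1) by (auto simp: differentiable_manifold_def)
  then have r: "r = DIM('e)"
    using dim_eq_card[of B UNIV] by simp
  \<comment> \<open>A finite nonempty \<open>topspace U\<close> forces \<open>d = 0\<close>, hence
    \<open>r \<le> 1\<close>, and a single experiment suffices.\<close>
  have enough: "r \<le> card (topspace U)" if "finite (topspace U)"
  proof -
    have "r \<le> 1"
      using infinite_manifold[OF assms(4) _ assms(7)] assms(8) that by linarith
    then show ?thesis
      using that assms(7) card_gt_0_iff[of "topspace U"] by linarith
  qed
  have "X0 \<inter> P \<noteq> {}" if P: "openin X P" "P \<noteq> {}" for P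
  proof -
    obtain z where z: "z \<in> P" using P by blast
    then have "z \<in> topspace X"
      using openin_subset[OF P(1)] by blast
    then have "z \<in> (\<Union>c\<in>AX. fst c)"
      using assms(1) by (simp add: differentiable_manifold_def)
    then obtain D \<phi> where D: "(D, \<phi>) \<in> AX" "z \<in> D"
      by force
    then have "is_chart X (D, \<phi>)"
      using assms(1) by (auto simp: differentiable_manifold_def)
    then have chart: "openin X D" "open (\<phi> ` D)" "homeomorphic_map (subtopology X D) (top_of_set (\<phi> ` D)) \<phi>"
      by (simp_all add: is_chart_def)
    have top: "topspace (subtopology X D) = D"
      using openin_subset[OF chart(1)] by auto
    have inj: "inj_on \<phi> D"
      using chart(3) top by (simp add: homeomorphic_map_def homeomorphic_eq_everything_map)
    have inv: "inv_into D \<phi> (\<phi> x) = x" if "x \<in> D" for x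
      using inj that by (rule inv_into_f_f)
    have "openin (top_of_set (\<phi> ` D)) (\<phi> ` (P \<inter> D))"
      using homeomorphic_imp_open_map[OF chart(3)] P(1) by (auto simp: open_map_def openin_subtopology)
    then have openW: "open (\<phi> ` (P \<inter> D))"
      using chart(2) openin_open_eq by blast
    have "C1_on ((\<lambda>x. \<beta> x u) \<circ> inv_into D \<phi>) (\<phi> ` (P \<inter> D))" if "u \<in> topspace U" for u
      using assms(9)[OF that] D(1) unfolding C1_function_def C1_on_def
      by (fast intro: continuous_on_subset)
    moreover have "\<phi> ` (P \<inter> D) \<noteq> {}"
      using z D(2) by blast
    ultimately obtain W' T0 where W': "open W'" "W' \<noteq> {}" "W' \<subseteq> \<phi> ` (P \<inter> D)"
      and T0: "T0 \<subseteq> topspace U" "finite T0" "card T0 \<le> r"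
      and det: "\<And>p q u. \<lbrakk>p \<in> W'; q \<in> W'; \<And>v. v \<in> T0 \<Longrightarrow> \<beta> (inv_into D \<phi> p) v = \<beta> (inv_into D \<phi> q) v;
        u \<in> topspace U\<rbrakk> \<Longrightarrow> \<beta> (inv_into D \<phi> p) u = \<beta> (inv_into D \<phi> q) u"
      using finitely_many_functions_determine_all[OF openW,
          of "topspace U" "\<lambda>u. (\<lambda>x. \<beta> x u) \<circ> inv_into D \<phi>"] unfolding r comp_apply
      by blast
    define V where "V = {x \<in> D. \<phi> x \<in> W'}"
    have "openin (top_of_set (\<phi> ` D)) W'"
      using W'(1,3) by (intro open_subset) auto
    then have "openin (subtopology X D) {x \<in> topspace (subtopology X D). \<phi> x \<in> W'}"
      by (rule openin_continuous_map_preimage[OF homeomorphic_imp_continuous_map[OF chart(3)]])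
    then have "openin X V"
      unfolding top V_def using chart(1) openin_trans_full by blast
    \<comment> \<open>Padding to exactly \<open>r\<close> experiments is harmless: equal responses
      on \<open>T1\<close> include equal responses on \<open>T0\<close>.\<close>
    obtain T1 where T1: "T0 \<subseteq> T1" "T1 \<subseteq> topspace U" "finite T1" "card T1 = r"
      using finite_subset_extend_card[OF T0(2,1,3) enough] by blast
    obtain w where w: "set w = T1" "distinct w"
      using finite_distinct_list[OF T1(3)] by blast
    have "w \<in> distinct_tuples r (topspace U)"
      using w T1 by (auto simp: distinct_tuples_def distinct_card)
    moreover have "w \<notin> bad_tuples \<beta> (topspace U) r V"
    proof
      assume "w \<in> bad_tuples \<beta> (topspace U) r V"
      then obtain x1 x2 u where x: "x1 \<in> V" "x2 \<in> V" and u: "u \<in> topspace U" "\<beta> x1 u \<noteq> \<beta> x2 u"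
        and eq: "map (\<beta> x1) w = map (\<beta> x2) w"
        by (auto simp: bad_tuples_def distinguishable_def)
      have "\<beta> x1 v = \<beta> x2 v" if "v \<in> T0" for v
        using eq that w(1) T1(1) by auto
      \<comment> \<open>By \<open>det\<close>, agreement on \<open>T0\<close> spreads to every
        experiment, including the distinguishing \<open>u\<close>.\<close>
      then show False
        using det[of "\<phi> x1" "\<phi> x2" u] x u inv by (auto simp: V_def)
    qed
    ultimately have "V \<subseteq> X0"
      using \<open>openin X V\<close> by (auto simp: X0_def good_tuples_def)
    moreover have "\<exists>x. x \<in> V \<inter> P"
      using W'(2,3) by (force simp: V_def)
    ultimately show ?thesis
      by blast
  qed
  then have "X closure_of X0 = topspace X"
    by (simp add: dense_intersects_open)
  moreover have "openin X X0"
    unfolding X0_def by blast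
  ultimately show ?thesis
    unfolding X0_def by blast
qed

end
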